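(* Let $n\ge 1$ be a natural number. Then: (i) if $n\equiv 0\pmod 4$: $\displaystyle 4^{\lfloor n/2\rfloor}\,\big(\lfloor n/2\rfloor\big)! = 2\prod_{\lambda=0}^{\lfloor (n-4)/4\rfloor}\big(n^2-(4\lambda)^2\big)$; (ii) if $n\equiv 1\pmod 4$: $\displaystyle 4^{\lfloor n/2\rfloor}\,\big(\lfloor n/2\rfloor\big)! = \prod_{\lambda=1}^{\lfloor (n-1)/4\rfloor}\big((n+1)^2-(4\lambda-2)^2\big)$; (iii) if $n\equiv 2\pmod 4$: $\displaystyle 4^{\lfloor n/2\rfloor}\,\big(\lfloor n/2\rfloor\big)! = 2n\prod_{\lambda=1}^{\lfloor (n-2)/4\rfloor}\big(n^2-(4\lambda-2)^2\big)$; (iv) if $n\equiv 3\pmod 4$: $\displaystyle 4^{\lfloor n/2\rfloor}\,\big(\lfloor n/2\rfloor\big)! = (n+1)\prod_{\lambda=1}^{\lfloor (n-3)/4\rfloor}\big((n+1)^2-(4\lambda)^2\big)$.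
   Context: Empty products equal $1$. *)

theory Defs imports Main begin

end

theory Submission imports Defs begin

text \<open>
  Write \<open>m = n div 2\<close>. The left-hand side is the product of the multiples \<open>4 j\<close> with
  \<open>1 \<le> j \<le> m\<close>, and the right-hand side is the same product with the factors paired off
  symmetrically about their midpoint. A difference of squares \<open>a\<^sup>2 - b\<^sup>2 = (a - b) (a + b)\<close>
  is exactly such a pair.

  Two pairings occur. If \<open>m = 2 k\<close>, the midpoint lies between \<open>k\<close> and \<open>k + 1\<close>, and every
  \<open>j\<close> has a partner: \<open>k + 1 - l\<close> is paired with \<open>k + l\<close>. If \<open>m = 2 k + 1\<close>, the midpoint
  is \<open>k + 1\<close> itself; it stays single, and \<open>k + 1 - l\<close> is paired with \<open>k + 1 + l\<close>. The
  lemmas \<open>prod_pairs_about_gap\<close> and \<open>prod_pairs_about_midpoint\<close> evaluate the two products.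
  They settle \<open>n = 4 k + 1\<close> and \<open>n = 4 k + 3\<close> directly. The even cases follow from them by
  adding one factor: for \<open>n = 4 k + 2\<close> the product is that of \<open>4 k + 1\<close>, and the prefactor
  \<open>2 n = 4 (2 k + 1)\<close> supplies the last multiple; for \<open>n = 4 (k + 1)\<close> the factors with
  \<open>\<lambda> \<ge> 1\<close> are those of \<open>4 k + 3\<close>, and the term \<open>n\<^sup>2\<close> at \<open>\<lambda> = 0\<close> together with the
  prefactor \<open>2\<close> gives the midpoint \<open>4 (k + 1)\<close> times the last multiple \<open>4 (2 k + 2)\<close>.
\<close>

lemma atLeastAtMost_int_Suc: "{1..int (Suc k)} = insert (int (Suc k)) {1..int k}"
  by auto

lemma fact_mult_prod_shift:
  "fact c * (\<Prod>l = 1..int k. int c + l) = (fact (c + k) :: int)"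
proof (induction k)
  case 0
  then show ?case by simp
next
  case (Suc k)
  have "fact c * (\<Prod>l = 1..int (Suc k). int c + l)
      = (int c + int (Suc k)) * (fact c * (\<Prod>l = 1..int k. int c + l))"
    unfolding atLeastAtMost_int_Suc by (simp add: algebra_simps)
  also have "\<dots> = fact (c + Suc k)"
    unfolding Suc.IH by (simp add: algebra_simps)
  finally show ?case .
qed

lemma prod_descending_eq_fact:
  "(\<Prod>l = 1..int k. int k + 1 - l) = fact k"
proof -
  have "(\<Prod>l = 1..int k. int k + 1 - l) = (\<Prod>l = 1..int k. l)"
    by (rule prod.reindex_bij_witness[where i = "\<lambda>l. int k + 1 - l" and j = "\<lambda>l. int k + 1 - l"]) auto
  then show ?thesis
    using fact_mult_prod_shift[of 0 k] by simp
qed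

text \<open>
  The factors \<open>k + 1 - l\<close> run through \<open>1, \<dots>, k\<close> and the factors \<open>c + l\<close> through
  \<open>c + 1, \<dots>, c + k\<close>. The choices \<open>c = k\<close> and \<open>c = k + 1\<close> give the two pairings; in both,
  multiplying by \<open>c!\<close> avoids a quotient of factorials.
\<close>

lemma fact_mult_prod_pairs:
  "fact c * (\<Prod>l = 1..int k. (4 * (int k + 1 - l)) * (4 * (int c + l)))
     = 4 ^ (2 * k) * fact k * (fact (c + k) :: int)"
proof -
  have "(\<Prod>l = 1..int k. (4 * (int k + 1 - l)) * (4 * (int c + l)))
      = 4 ^ k * (\<Prod>l = 1..int k. int k + 1 - l) * (4 ^ k * (\<Prod>l = 1..int k. int c + l))"
    by (simp only: prod.distrib prod_constant) simp
  then show ?thesis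
    unfolding prod_descending_eq_fact
    by (simp add: fact_mult_prod_shift[symmetric] mult_2 power_add)
qed

lemma prod_pairs_about_gap:
  "(\<Prod>l = 1..int k. (4 * int k + 2)\<^sup>2 - (4 * l - 2)\<^sup>2) = 4 ^ (2 * k) * fact (2 * k)"
proof -
  have "(4 * int k + 2)\<^sup>2 - (4 * l - 2)\<^sup>2 = (4 * (int k + 1 - l)) * (4 * (int k + l))" for l
    by (simp add: power2_eq_square algebra_simps)
  then have "fact k * (\<Prod>l = 1..int k. (4 * int k + 2)\<^sup>2 - (4 * l - 2)\<^sup>2)
      = fact k * (4 ^ (2 * k) * fact (2 * k))"
    using fact_mult_prod_pairs[of k k] by (simp add: mult_2)
  then show ?thesis by simp
qed

lemma prod_pairs_about_midpoint:
  "4 * (int k + 1) * (\<Prod>l = 1..int k. (4 * int k + 4)\<^sup>2 - (4 * l)\<^sup>2)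
     = 4 ^ (2 * k + 1) * fact (2 * k + 1)"
proof -
  let ?P = "\<Prod>l = 1..int k. (4 * int k + 4)\<^sup>2 - (4 * l)\<^sup>2"
  have "(4 * int k + 4)\<^sup>2 - (4 * l)\<^sup>2 = (4 * (int k + 1 - l)) * (4 * (int (k + 1) + l))" for l
    by (simp add: power2_eq_square algebra_simps)
  then have "fact (k + 1) * ?P = 4 ^ (2 * k) * fact k * fact (k + 1 + k)"
    using fact_mult_prod_pairs[of "k + 1" k] by simp
  moreover have "(fact (k + 1) :: int) = (int k + 1) * fact k"
    by (simp add: algebra_simps)
  moreover have "k + 1 + k = 2 * k + 1"
    by simp
  ultimately have "fact k * ((int k + 1) * ?P) = fact k * (4 ^ (2 * k) * fact (2 * k + 1))"
    by (simp only: ac_simps)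
  then have "(int k + 1) * ?P = 4 ^ (2 * k) * fact (2 * k + 1)"
    by simp
  then show ?thesis by (simp only: power_add power_one_right mult.assoc mult.left_commute)
qed

theorem theorem8:
  fixes n :: nat
  assumes "n \<ge> 1"
  shows
    "(n mod 4 = 0 \<longrightarrow>
        (4::int) ^ (n div 2) * fact (n div 2) =
          2 * (\<Prod>l = 0..(int n - 4) div 4. (int n)\<^sup>2 - (4 * l)\<^sup>2)) \<and>
     (n mod 4 = 1 \<longrightarrow>
        (4::int) ^ (n div 2) * fact (n div 2) =
          (\<Prod>l = 1..(int n - 1) div 4. (int n + 1)\<^sup>2 - (4 * l - 2)\<^sup>2)) \<and>
     (n mod 4 = 2 \<longrightarrow>
        (4::int) ^ (n div 2) * fact (n div 2) =
          2 * int n * (\<Prod>l = 1..(int n - 2) div 4. (int n)\<^sup>2 - (4 * l - 2)\<^sup>2)) \<and>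
     (n mod 4 = 3 \<longrightarrow>
        (4::int) ^ (n div 2) * fact (n div 2) =
          (int n + 1) * (\<Prod>l = 1..(int n - 3) div 4. (int n + 1)\<^sup>2 - (4 * l)\<^sup>2))"
proof (intro conjI impI)
  assume "n mod 4 = 0"
  \<comment> \<open>\<open>n = 4 (k + 1)\<close> rather than \<open>4 k\<close>, so that the range of the product is \<open>0..k\<close>.\<close>
  with assms obtain k where n: "n = 4 * k + 4"
    by (metis One_nat_def Suc_le_eq add.commute mod_0_imp_dvd dvdE mult_Suc_right mult_is_0
        not0_implies_Suc not_gr_zero)
  let ?P = "\<Prod>l = 1..int k. (4 * int k + 4)\<^sup>2 - (4 * l)\<^sup>2"
  have range: "{0..(int n - 4) div 4} = insert 0 {1..int k}"
    using n by auto
  have half: "n div 2 = Suc (2 * k + 1)"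
    using n by simp
  have "(\<Prod>l = 0..(int n - 4) div 4. (int n)\<^sup>2 - (4 * l)\<^sup>2) = (4 * int k + 4)\<^sup>2 * ?P"
    unfolding range using n by simp
  then have "2 * (\<Prod>l = 0..(int n - 4) div 4. (int n)\<^sup>2 - (4 * l)\<^sup>2)
      = 4 * int (2 * k + 2) * (4 * (int k + 1) * ?P)"
    by (simp add: power2_eq_square algebra_simps)
  also have "\<dots> = 4 * int (2 * k + 2) * (4 ^ (2 * k + 1) * fact (2 * k + 1))"
    unfolding prod_pairs_about_midpoint ..
  also have "\<dots> = 4 ^ (n div 2) * fact (n div 2)"
    unfolding half fact_Suc power_Suc by (simp add: algebra_simps)
  finally show "(4::int) ^ (n div 2) * fact (n div 2) =
      2 * (\<Prod>l = 0..(int n - 4) div 4. (int n)\<^sup>2 - (4 * l)\<^sup>2)" ..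
next
  assume "n mod 4 = 1"
  then obtain k where n: "n = 4 * k + 1"
    by (metis mult_div_mod_eq)
  have "(int n - 1) div 4 = int k" "int n + 1 = 4 * int k + 2" "n div 2 = 2 * k"
    using n by simp_all
  then show "(4::int) ^ (n div 2) * fact (n div 2) =
      (\<Prod>l = 1..(int n - 1) div 4. (int n + 1)\<^sup>2 - (4 * l - 2)\<^sup>2)"
    by (simp only: prod_pairs_about_gap)
next
  assume "n mod 4 = 2"
  then obtain k where n: "n = 4 * k + 2"
    by (metis mult_div_mod_eq)
  have "(int n - 2) div 4 = int k" "int n = 4 * int k + 2" and half: "n div 2 = Suc (2 * k)"
    using n by simp_all
  then have "2 * int n * (\<Prod>l = 1..(int n - 2) div 4. (int n)\<^sup>2 - (4 * l - 2)\<^sup>2)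
      = 4 * int (2 * k + 1) * (4 ^ (2 * k) * fact (2 * k))"
    by (simp add: prod_pairs_about_gap)
  also have "\<dots> = 4 ^ (n div 2) * fact (n div 2)"
    unfolding half fact_Suc power_Suc by (simp add: algebra_simps)
  finally show "(4::int) ^ (n div 2) * fact (n div 2) =
      2 * int n * (\<Prod>l = 1..(int n - 2) div 4. (int n)\<^sup>2 - (4 * l - 2)\<^sup>2)" ..
next
  assume "n mod 4 = 3"
  then obtain k where n: "n = 4 * k + 3"
    by (metis mult_div_mod_eq)
  have "(int n - 3) div 4 = int k" "int n + 1 = 4 * int k + 4" "n div 2 = 2 * k + 1"
    using n by simp_all
  then show "(4::int) ^ (n div 2) * fact (n div 2) =
      (int n + 1) * (\<Prod>l = 1..(int n - 3) div 4. (int n + 1)\<^sup>2 - (4 * l)\<^sup>2)"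
    by (simp only: prod_pairs_about_midpoint[symmetric]) simp
qed

end
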